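(* For arbitrary integers $r,t\geq 2$, we have \[f(r,t) \leq F(r,t)<(r+1)^{2r+1}t^{2r+1}.\]
   Context: An $r$-graph is an $r$-uniform multi-hypergraph $G=(V,E)$: $V$ is a set of vertices and $E$ is a multiset of $r$-element subsets of $V$. A matching is a set of pairwise disjoint edges; a $t$-matching is a matching of size $t$. An $r$-graph is $r$-partite if its vertex set is a disjoint union $V=V_1\cup\cdots\cup V_r$ of $r$ parts and every edge meets each part in exactly one vertex. An $(f,t)$-colored $r$-graph is an $r$-graph whose edges (members of the multiset $E$, so different copies of the same $r$-set are different edges) are colored with $f$ colors such that every one of the $f$ color classes is a $t$-matching (exactly $t$ pairwise disjoint edges). A rainbow $t$-matching is a set of $t$ pairwise disjoint edges having $t$ distinct colors. $F(r,t)$ denotes the largest $f$ such that there exists an $(f,t)$-colored (not necessarily $r$-partite) $r$-graph with no rainbow $t$-matching. $f(r,t)$ denotes the largest $f$ such that there exists an $(f,t)$-colored $r$-partite $r$-graph with no rainbow $t$-matching. *)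

theory Defs
  imports Main "HOL-Library.Multiset" "HOL-Library.Disjoint_Sets" "HOL-Library.Extended_Nat"
begin

definition r_graph :: "nat \<Rightarrow> 'v set \<Rightarrow> 'v set multiset \<Rightarrow> bool" where
  "r_graph r V E \<longleftrightarrow> (\<forall>e\<in>#E. e \<subseteq> V \<and> finite e \<and> card e = r)"

definition r_partite :: "nat \<Rightarrow> 'v set \<Rightarrow> 'v set multiset \<Rightarrow> bool" where
  "r_partite r V E \<longleftrightarrow>
     (\<exists>P :: nat \<Rightarrow> 'v set. V = (\<Union>i<r. P i) \<and> disjoint_family_on P {..<r} \<and>
        (\<forall>e\<in>#E. \<forall>i<r. card (e \<inter> P i) = 1))"

text \<open>
  The members of the multiset \<open>E\<close>, with multiplicity: the \<open>k\<close>-th copy of \<open>e\<close> is the pair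
  \<open>(e, k)\<close>. Matchings and colorings live on these copies, so parallel edges are different edges
  and may receive different colors.
\<close>

definition edge_copies :: "'v set multiset \<Rightarrow> ('v set \<times> nat) set" where
  "edge_copies E = {(e, k). k < count E e}"

definition t_matching :: "nat \<Rightarrow> 'v set multiset \<Rightarrow> ('v set \<times> nat) set \<Rightarrow> bool" where
  "t_matching t E M \<longleftrightarrow>
     M \<subseteq> edge_copies E \<and> pairwise (\<lambda>p q. disjnt (fst p) (fst q)) M \<and> finite M \<and> card M = t"

definition colored_r_graph ::
  "nat \<Rightarrow> nat \<Rightarrow> nat \<Rightarrow> 'v set \<Rightarrow> 'v set multiset \<Rightarrow> ('v set \<times> nat \<Rightarrow> nat) \<Rightarrow> bool" where
  "colored_r_graph r f t V E c \<longleftrightarrow>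
     r_graph r V E \<and> c ` edge_copies E \<subseteq> {..<f} \<and>
     (\<forall>i<f. t_matching t E {p \<in> edge_copies E. c p = i})"

definition rainbow_t_matching ::
  "nat \<Rightarrow> 'v set multiset \<Rightarrow> ('v set \<times> nat \<Rightarrow> nat) \<Rightarrow> ('v set \<times> nat) set \<Rightarrow> bool" where
  "rainbow_t_matching t E c M \<longleftrightarrow> t_matching t E M \<and> inj_on c M"

text \<open>
  Vertices are natural numbers below. This is no restriction: only the finitely many vertices on
  edges matter (see \<open>rainbow_free_nat\<close> and \<open>partite_rainbow_free_nat\<close>).
\<close>

definition rainbow_free_sizes :: "nat \<Rightarrow> nat \<Rightarrow> nat set" where
  "rainbow_free_sizes r t =
     {f. \<exists>(V :: nat set) E c. colored_r_graph r f t V E c \<and> (\<nexists>M. rainbow_t_matching t E c M)}"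

definition partite_rainbow_free_sizes :: "nat \<Rightarrow> nat \<Rightarrow> nat set" where
  "partite_rainbow_free_sizes r t =
     {f. \<exists>(V :: nat set) E c. colored_r_graph r f t V E c \<and> r_partite r V E \<and>
        (\<nexists>M. rainbow_t_matching t E c M)}"

text \<open>
  The extremal numbers are valued in \<^typ>\<open>enat\<close>, so that they are \<open>\<infinity>\<close> if there is no largest
  number of colors; a finite value is an attained maximum (see \<open>max_colors_eq_enat_iff\<close> and
  \<open>max_colors_partite_eq_enat_iff\<close>).
\<close>

definition max_colors :: "nat \<Rightarrow> nat \<Rightarrow> enat" where
  "max_colors r t = Sup (enat ` rainbow_free_sizes r t)"

definition max_colors_partite :: "nat \<Rightarrow> nat \<Rightarrow> enat" where
  "max_colors_partite r t = Sup (enat ` partite_rainbow_free_sizes r t)"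


lemma zero_in_partite_rainbow_free_sizes:
  assumes "t \<ge> 1"
  shows "0 \<in> partite_rainbow_free_sizes r t"
proof -
  have "colored_r_graph r 0 t ({} :: nat set) {#} (\<lambda>_. 0)"
    by (simp add: colored_r_graph_def r_graph_def edge_copies_def)
  moreover have "r_partite r ({} :: nat set) {#}"
    by (auto simp: r_partite_def disjoint_family_on_def intro!: exI[of _ "\<lambda>_. {}"])
  moreover have "\<nexists>M. rainbow_t_matching t ({#} :: nat set multiset) (\<lambda>_. 0) M"
    using assms by (auto simp: rainbow_t_matching_def t_matching_def edge_copies_def)
  ultimately show ?thesis
    unfolding partite_rainbow_free_sizes_def by blast
qed

lemma zero_in_rainbow_free_sizes:
  assumes "t \<ge> 1"
  shows "0 \<in> rainbow_free_sizes r t"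
  using zero_in_partite_rainbow_free_sizes[OF assms, of r]
  unfolding partite_rainbow_free_sizes_def rainbow_free_sizes_def by blast

lemma Sup_enat_image_eq_enat_iff:
  assumes "A \<noteq> {}"
  shows "Sup (enat ` A) = enat n \<longleftrightarrow> n \<in> A \<and> (\<forall>m\<in>A. m \<le> n)"
proof
  assume eq: "Sup (enat ` A) = enat n"
  then have fin: "finite (enat ` A)"
    using assms by (auto simp: Sup_enat_def split: if_splits)
  then have "Max (enat ` A) = enat n"
    using assms eq by (auto simp: Sup_enat_def)
  then show "n \<in> A \<and> (\<forall>m\<in>A. m \<le> n)"
    using fin assms Max_in[of "enat ` A"] Max_ge[of "enat ` A"] by fastforce
next
  assume "n \<in> A \<and> (\<forall>m\<in>A. m \<le> n)"
  then show "Sup (enat ` A) = enat n"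
    by (intro cSup_eq_maximum) auto
qed

lemma max_colors_eq_enat_iff:
  assumes "t \<ge> 1"
  shows "max_colors r t = enat n \<longleftrightarrow>
    n \<in> rainbow_free_sizes r t \<and> (\<forall>m\<in>rainbow_free_sizes r t. m \<le> n)"
  unfolding max_colors_def
  using zero_in_rainbow_free_sizes[OF assms] by (intro Sup_enat_image_eq_enat_iff) auto

lemma max_colors_partite_eq_enat_iff:
  assumes "t \<ge> 1"
  shows "max_colors_partite r t = enat n \<longleftrightarrow>
    n \<in> partite_rainbow_free_sizes r t \<and> (\<forall>m\<in>partite_rainbow_free_sizes r t. m \<le> n)"
  unfolding max_colors_partite_def
  using zero_in_partite_rainbow_free_sizes[OF assms] by (intro Sup_enat_image_eq_enat_iff) auto

lemma relabel_vertices: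
  fixes V :: "'v set"
  assumes col: "colored_r_graph r f t V E c" and free: "\<nexists>M. rainbow_t_matching t E c M"
  shows "\<exists>(V' :: nat set) E' c'. colored_r_graph r f t V' E' c' \<and>
    (r_partite r V E \<longrightarrow> r_partite r V' E') \<and> (\<nexists>M. rainbow_t_matching t E' c' M)"
proof -
  define U where "U = \<Union>(set_mset E)"
  have edge: "e \<subseteq> V" "finite e" "card e = r" "e \<subseteq> U" if "e \<in># E" for e
    using col that by (auto simp: colored_r_graph_def r_graph_def U_def)
  have "finite U"
    unfolding U_def using edge by blast
  then obtain g :: "'v \<Rightarrow> nat" where g: "inj_on g U"
    by (metis finite_imp_inj_to_nat_seg)
  have "set_mset E \<subseteq> Pow U"
    unfolding U_def by blast
  then have injE: "inj_on ((`) g) (set_mset E)"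
    by (rule inj_on_subset[OF inj_on_image_Pow[OF g]])
  define E' where "E' = image_mset ((`) g) E"
  define h :: "'v set \<times> nat \<Rightarrow> nat set \<times> nat" where "h = (\<lambda>(e, k). (g ` e, k))"
  define h' where "h' = inv_into (edge_copies E) h"
  define c' where "c' = (\<lambda>p. c (h' p))"
  have mem: "fst p \<in># E" if "p \<in> edge_copies E" for p
    using that by (auto simp: edge_copies_def simp flip: count_greater_zero_iff)
  have count: "count E' (g ` e) = count E e" if "e \<in># E" for e
  proof -
    have "count E' (g ` e) = (\<Sum>x\<in>{x \<in> set_mset E. g ` x = g ` e}. count E x)"
      unfolding E'_def count_image_mset by (intro sum.cong) auto
    also have "{x \<in> set_mset E. g ` x = g ` e} = {e}"
      using injE that by (auto dest: inj_onD)
    finally show ?thesis by simp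
  qed
  have injh: "inj_on h (edge_copies E)"
  proof (rule inj_onI)
    fix p q assume pq: "p \<in> edge_copies E" "q \<in> edge_copies E" "h p = h q"
    then have "fst p = fst q" "snd p = snd q"
      using inj_onD[OF injE _ mem[OF pq(1)] mem[OF pq(2)]] by (auto simp: h_def split_beta)
    then show "p = q" by (rule prod_eqI)
  qed
  have imh: "h ` edge_copies E = edge_copies E'"
  proof (intro equalityI subsetI)
    fix p assume "p \<in> h ` edge_copies E"
    then obtain e k where ek: "(e, k) \<in> edge_copies E" "p = (g ` e, k)"
      by (auto simp: h_def)
    then show "p \<in> edge_copies E'"
      using count[of e] mem[OF ek(1)] by (simp add: edge_copies_def)
  next
    fix p assume p: "p \<in> edge_copies E'"
    obtain d k where [simp]: "p = (d, k)" by (cases p)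
    have k: "k < count E' d" using p by (simp add: edge_copies_def)
    then have "d \<in># E'" by (simp flip: count_greater_zero_iff)
    then obtain e where e: "e \<in># E" "d = g ` e" by (auto simp: E'_def)
    then have "(e, k) \<in> edge_copies E" using k count by (simp add: edge_copies_def)
    then show "p \<in> h ` edge_copies E" using e by (force simp: h_def)
  qed
  have h'h: "h' (h p) = p" if "p \<in> edge_copies E" for p
    using that injh by (simp add: h'_def)
  have disj: "disjnt (fst (h p)) (fst (h q)) \<longleftrightarrow> disjnt (fst p) (fst q)"
    if "p \<in> edge_copies E" "q \<in> edge_copies E" for p q
  proof -
    have "fst p \<subseteq> U" "fst q \<subseteq> U" using that mem edge by blast+
    then have "g ` (fst p \<inter> fst q) = g ` fst p \<inter> g ` fst q"
      using g by (intro inj_on_image_Int) 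
    then show ?thesis by (auto simp: disjnt_def h_def split_beta)
  qed
  have match: "t_matching t E' (h ` M) \<longleftrightarrow> t_matching t E M" if "M \<subseteq> edge_copies E" for M
  proof -
    have inj: "inj_on h M" using injh that by (rule inj_on_subset)
    have "pairwise (\<lambda>p q. disjnt (fst p) (fst q)) (h ` M) \<longleftrightarrow>
          pairwise (\<lambda>p q. disjnt (fst p) (fst q)) M"
      unfolding pairwise_def using disj that inj
      by (smt (verit, ccfv_threshold) imageE imageI inj_on_eq_iff subsetD)
    moreover have "h ` M \<subseteq> edge_copies E'" using imh that by blast
    ultimately show ?thesis
      using that inj by (simp add: t_matching_def card_image finite_image_iff)
  qed
  have cls: "{p \<in> edge_copies E'. c' p = i} = h ` {p \<in> edge_copies E. c p = i}" for i
    unfolding imh[symmetric] by (auto simp: c'_def h'h)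
  have "r_graph r (g ` U) E'"
  proof -
    have "g ` e \<subseteq> g ` U \<and> finite (g ` e) \<and> card (g ` e) = r" if "e \<in># E" for e
      using edge[OF that] inj_on_subset[OF g edge(4)[OF that]]
      by (simp add: card_image image_mono)
    then show ?thesis by (auto simp: r_graph_def E'_def)
  qed
  moreover have "c' ` edge_copies E' \<subseteq> {..<f}"
    using col unfolding imh[symmetric] by (auto simp: c'_def h'h colored_r_graph_def)
  moreover have "\<forall>i<f. t_matching t E' {p \<in> edge_copies E'. c' p = i}"
    using col by (simp add: cls match colored_r_graph_def)
  ultimately have 1: "colored_r_graph r f t (g ` U) E' c'"
    by (simp add: colored_r_graph_def)
  have 2: "r_partite r (g ` U) E'" if part: "r_partite r V E"
  proof -
    obtain P where P: "V = (\<Union>i<r. P i)" "disjoint_family_on P {..<r}"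
      "\<forall>e\<in>#E. \<forall>i<r. card (e \<inter> P i) = 1"
      using part unfolding r_partite_def by (elim exE conjE)
    define Q where "Q i = g ` (P i \<inter> U)" for i
    have "U \<subseteq> V" using edge(1) unfolding U_def by (rule Union_least)
    then have "U = (\<Union>i<r. P i \<inter> U)" using P(1) by blast
    then have "g ` U = (\<Union>i<r. Q i)" unfolding Q_def by (metis image_UN)
    moreover have "disjoint_family_on Q {..<r}"
      unfolding disjoint_family_on_def
    proof (intro ballI impI)
      fix i j assume "i \<in> {..<r}" "j \<in> {..<r}" "i \<noteq> j"
      then have "P i \<inter> P j = {}" using P(2) by (simp add: disjoint_family_on_def)
      moreover have "Q i \<inter> Q j = g ` ((P i \<inter> U) \<inter> (P j \<inter> U))"
        unfolding Q_def by (rule inj_on_image_Int[OF g, symmetric]) auto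
      ultimately show "Q i \<inter> Q j = {}" by auto
    qed
    moreover have "card (d \<inter> Q i) = 1" if d: "d \<in># E'" and i: "i < r" for d i
    proof -
      obtain e where e: "e \<in># E" "d = g ` e" using d by (auto simp: E'_def)
      have "d \<inter> Q i = g ` (e \<inter> (P i \<inter> U))"
        unfolding Q_def e(2) by (rule inj_on_image_Int[OF g edge(4)[OF e(1)], symmetric]) auto
      also have "e \<inter> (P i \<inter> U) = e \<inter> P i" using edge(4)[OF e(1)] by auto
      finally have "d \<inter> Q i = g ` (e \<inter> P i)" .
      moreover have "inj_on g (e \<inter> P i)"
        using g by (rule inj_on_subset) (use edge(4)[OF e(1)] in auto)
      ultimately show ?thesis
        using P(3) e(1) i by (simp add: card_image)
    qed
    ultimately show ?thesis unfolding r_partite_def by (intro exI[of _ Q]) simp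
  qed
  have 3: "\<nexists>M. rainbow_t_matching t E' c' M"
  proof
    assume "\<exists>M. rainbow_t_matching t E' c' M"
    then obtain M where M: "t_matching t E' M" "inj_on c' M"
      by (auto simp: rainbow_t_matching_def)
    then have "M \<subseteq> h ` edge_copies E" by (simp add: t_matching_def imh)
    then obtain N where N: "N \<subseteq> edge_copies E" "M = h ` N"
      by (auto simp: subset_image_iff)
    have "inj_on (c' \<circ> h) N"
      using M(2) N injh by (auto intro: comp_inj_on inj_on_subset)
    moreover have "(c' \<circ> h) p = c p" if "p \<in> N" for p
      using N(1) that by (simp add: c'_def h'h subsetD)
    ultimately have "inj_on c N"
      by (simp cong: inj_on_cong)
    then show False
      using free M(1) N match by (auto simp: rainbow_t_matching_def)
  qed
  show ?thesis
    by (intro exI[of _ "g ` U"] exI[of _ E'] exI[of _ c'] conjI impI 1 2 3)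
qed

lemma rainbow_free_nat:
  fixes V :: "'v set"
  assumes "colored_r_graph r f t V E c" and "\<nexists>M. rainbow_t_matching t E c M"
  shows "f \<in> rainbow_free_sizes r t"
  using relabel_vertices[OF assms] unfolding rainbow_free_sizes_def by blast

lemma partite_rainbow_free_nat:
  fixes V :: "'v set"
  assumes "colored_r_graph r f t V E c" and "r_partite r V E"
    and "\<nexists>M. rainbow_t_matching t E c M"
  shows "f \<in> partite_rainbow_free_sizes r t"
  using relabel_vertices[OF assms(1,3)] assms(2) unfolding partite_rainbow_free_sizes_def by blast

end

theory Submission
  imports Defs
begin

text \<open>
  Call a vertex set \<open>S\<close> robust if no small set of vertices outside \<open>S\<close>, together with a small set
  of forbidden colors, can block all the edges that contain \<open>S\<close>. The bound rests on two facts.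

  Disjoint robust sets can be enlarged greedily to disjoint edges of distinct colors: each new edge
  only has to avoid the edges chosen so far, the robust sets still waiting, and the colors already
  taken (\<open>robust_family_extends_to_rainbow_matching\<close>). So a color class all of whose \<open>t\<close> edges
  contain a robust set yields a rainbow \<open>t\<close>-matching.

  Otherwise every color has an edge without a robust subset. If there are many colors, these edges
  cannot all lack robust subsets (\<open>large_rainbow_set_has_robust_subset\<close>). Indeed the empty set is
  not robust, so a few vertices meet nearly all of these edges, and some vertex \<open>w\<^sub>1\<close> lies in a
  positive proportion of them; since \<open>{w\<^sub>1}\<close> is not robust either, some pair \<open>{w\<^sub>1, w\<^sub>2}\<close> still lies
  in many of them, and so on. After \<open>r\<close> steps the set obtained is a whole edge that occurs in at
  least \<open>t\<close> colors, and such a set is robust, as its copies can only be blocked through their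
  colors.

  Each step costs a factor of at most \<open>(t - 1) r + 1\<close>, so a rainbow-free coloring has fewer than
  \<open>t ((t - 1) r + 1)\<^sup>r\<close> colors, which is far below the bound claimed.
\<close>

section \<open>Robust vertex sets\<close>

text \<open>
  Edges are elements of a set \<open>A\<close>, and \<open>X\<close> gives their vertex sets, so that parallel edges of
  different colors are kept apart.
\<close>

definition robust ::
  "nat \<Rightarrow> nat \<Rightarrow> 'e set \<Rightarrow> ('e \<Rightarrow> 'v set) \<Rightarrow> ('e \<Rightarrow> 'c) \<Rightarrow> 'v set \<Rightarrow> bool" where
  "robust m s A X c S \<longleftrightarrow>
     (\<forall>W C. finite W \<and> card W \<le> m \<and> W \<inter> S = {} \<and> finite C \<and> card C \<le> s \<longrightarrow>
        (\<exists>p\<in>A. S \<subseteq> X p \<and> X p \<inter> W = {} \<and> c p \<notin> C))"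

lemma robustE:
  assumes "robust m s A X c S" "finite W" "card W \<le> m" "W \<inter> S = {}" "finite C" "card C \<le> s"
  obtains p where "p \<in> A" "S \<subseteq> X p" "X p \<inter> W = {}" "c p \<notin> C"
  using assms unfolding robust_def by metis

section \<open>From disjoint robust sets to rainbow matchings\<close>

text \<open>
  The greedy choice: the robust sets are replaced by edges one at a time. The blocking set handed
  to robustness is the union of the other members of the current family, a mixture of edges and
  robust sets, so that the family stays disjoint throughout.
\<close>

lemma robust_family_extends_to_rainbow_matching:
  assumes I: "finite I"
    and robust: "\<And>i. i \<in> I \<Longrightarrow> robust ((card I - 1) * r) (card I - 1) A X c (S i)"
    and disj: "disjoint_family_on S I"
    and S: "\<And>i. i \<in> I \<Longrightarrow> finite (S i) \<and> card (S i) \<le> r"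
    and X: "\<And>p. p \<in> A \<Longrightarrow> finite (X p) \<and> card (X p) \<le> r"
  shows "\<exists>g. g ` I \<subseteq> A \<and> disjoint_family_on (X \<circ> g) I \<and> inj_on (c \<circ> g) I"
proof -
  have "\<exists>g. g ` J \<subseteq> A \<and> disjoint_family_on (\<lambda>i. if i \<in> J then X (g i) else S i) I \<and>
      inj_on (c \<circ> g) J" if "J \<subseteq> I" for J
    using finite_subset[OF that I] that
  proof (induction J rule: finite_induct)
    case empty
    show ?case using disj by auto
  next
    case (insert j J)
    then obtain g where g: "g ` J \<subseteq> A" "inj_on (c \<circ> g) J"
      and dis: "disjoint_family_on (\<lambda>i. if i \<in> J then X (g i) else S i) I"
      by (metis insert_subset)
    define T where "T i = (if i \<in> J then X (g i) else S i)" for i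
    have T: "finite (T i) \<and> card (T i) \<le> r" if "i \<in> I" for i
      using S[OF that] X g(1) by (auto simp: T_def)
    have dT: "T i \<inter> T k = {}" if "i \<in> I" "k \<in> I" "i \<noteq> k" for i k
      using dis that unfolding disjoint_family_on_def T_def by blast
    have j: "j \<in> I" "j \<notin> J" "T j = S j"
      using insert by (auto simp: T_def)
    define W where "W = (\<Union>i\<in>I - {j}. T i)"
    have "card W \<le> (\<Sum>i\<in>I - {j}. card (T i))"
      unfolding W_def using I by (intro card_UN_le) auto
    also have "\<dots> \<le> card (I - {j}) * r"
      using sum_bounded_above[of "I - {j}" "\<lambda>i. card (T i)" r] T by auto
    finally have "card W \<le> (card I - 1) * r"
      using I j by simp
    moreover have "finite W"
      using I T by (auto simp: W_def)
    moreover have "W \<inter> S j = {}"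
      using dT[OF _ j(1)] unfolding W_def j(3)[symmetric] by blast
    moreover have "card (c ` g ` J) \<le> card I - 1"
    proof -
      have "card (c ` g ` J) \<le> card J"
        using insert.hyps(1) by (metis card_image_le finite_imageI le_trans)
      also have "card J \<le> card (I - {j})"
        using insert j I by (intro card_mono) auto
      finally show ?thesis using I j by simp
    qed
    ultimately obtain p where p: "p \<in> A" "X p \<inter> W = {}" "c p \<notin> c ` g ` J"
      using robustE[OF robust[OF j(1)]] insert.hyps(1) by (metis finite_imageI)
    define h where "h = g(j := p)"
    have h: "h i = g i" if "i \<in> J" for i
      using that j by (auto simp: h_def)
    have "h ` insert j J \<subseteq> A"
      using g(1) h p(1) by (auto simp: h_def)
    moreover have "inj_on (c \<circ> h) (insert j J)"
    proof -
      have "inj_on (c \<circ> h) J"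
        using g(2) h by (simp cong: inj_on_cong)
      moreover have "(c \<circ> h) j \<notin> (c \<circ> h) ` J"
        using p(3) h by (auto simp: h_def)
      ultimately show ?thesis
        using j by simp
    qed
    moreover have "disjoint_family_on (\<lambda>i. if i \<in> insert j J then X (h i) else S i) I"
    proof -
      have "(\<lambda>i. if i \<in> insert j J then X (h i) else S i) = T(j := X p)"
        using j by (auto simp: T_def h_def fun_eq_iff)
      moreover have "T i \<inter> X p = {}" if "i \<in> I" "i \<noteq> j" for i
        using p(2) that unfolding W_def by blast
      ultimately show ?thesis
        using dT by (auto simp: disjoint_family_on_def)
    qed
    ultimately show ?case by blast
  qed
  from this[of I] obtain g where "g ` I \<subseteq> A" "inj_on (c \<circ> g) I"
    "disjoint_family_on (\<lambda>i. if i \<in> I then X (g i) else S i) I"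
    by auto
  moreover from this(3) have "disjoint_family_on (X \<circ> g) I"
    by (simp add: disjoint_family_on_def)
  ultimately show ?thesis by blast
qed

section \<open>Finding robust sets\<close>

text \<open>
  Induction on the number \<open>n\<close> of vertices by which the edges in \<open>K\<close> exceed their common part \<open>S\<close>.
  If \<open>S\<close> is not robust, a blocking set of at most \<open>m\<close> vertices meets all but at most \<open>s\<close> of the
  edges, and one of its vertices, lying outside \<open>S\<close>, is in enough edges of \<open>K\<close> to enlarge \<open>S\<close>.
\<close>

lemma large_rainbow_set_has_robust_subset:
  fixes X :: "'e \<Rightarrow> 'v set" and c :: "'e \<Rightarrow> 'c"
  assumes "K \<subseteq> A" "finite K" "inj_on c K"
    and "\<And>p. p \<in> K \<Longrightarrow> S \<subseteq> X p \<and> finite (X p) \<and> card (X p) = card S + n"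
    and "card K \<ge> (s + 1) * (m + 1) ^ n"
  shows "\<exists>p\<in>K. \<exists>T\<subseteq>X p. robust m s A X c T"
  using assms
proof (induction n arbitrary: S K)
  case 0
  have X: "X p = S" if "p \<in> K" for p
    using 0(4)[OF that] by (intro card_subset_eq[symmetric]) auto
  have "robust m s A X c S"
    unfolding robust_def
  proof (intro allI impI)
    fix W and C :: "'c set"
    assume WC: "finite W \<and> card W \<le> m \<and> W \<inter> S = {} \<and> finite C \<and> card C \<le> s"
    have "card (c ` K) > card C"
      using 0(3,5) WC by (simp add: card_image)
    then have "\<not> c ` K \<subseteq> C"
      using WC by (meson card_mono not_le)
    then show "\<exists>p\<in>A. S \<subseteq> X p \<and> X p \<inter> W = {} \<and> c p \<notin> C"
      using X WC 0(1) by blast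
  qed
  moreover have "K \<noteq> {}"
    using 0(5) by auto
  ultimately show ?case using X by blast
next
  case (Suc n)
  define M where "M = (s + 1) * (m + 1) ^ n"
  have "M \<ge> s + 1"
    using mult_le_mono2[of 1 "(m + 1) ^ n" "s + 1"] by (simp add: M_def)
  have big: "card K \<ge> m * M + M"
    using Suc.prems(5) by (simp add: M_def algebra_simps)
  show ?case
  proof (cases "robust m s A X c S")
    case True
    have "K \<noteq> {}"
      using big \<open>M \<ge> s + 1\<close> by auto
    then show ?thesis using True Suc.prems(4) by blast
  next
    case False
    then obtain W C where W: "finite W" "card W \<le> m" "W \<inter> S = {}" and C: "finite C" "card C \<le> s"
      and block: "\<And>p. p \<in> A \<Longrightarrow> S \<subseteq> X p \<Longrightarrow> c p \<notin> C \<Longrightarrow> X p \<inter> W \<noteq> {}"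
      unfolding robust_def by blast
    \<comment> \<open>Pigeonhole: \<open>K\<close> is rainbow, so forbidding \<open>C\<close> removes at most \<open>s < M\<close> of its edges, and
      \<open>m M\<close> would bound the rest if every vertex of \<open>W\<close> were in fewer than \<open>M\<close> of them.\<close>
    have "\<exists>w\<in>W. card {p \<in> K. w \<in> X p} \<ge> M"
    proof (rule ccontr)
      assume "\<not> ?thesis"
      then have small: "card {p \<in> K. w \<in> X p} \<le> M - 1" if "w \<in> W" for w
        using that by fastforce
      have "K \<subseteq> {p \<in> K. c p \<in> C} \<union> (\<Union>w\<in>W. {p \<in> K. w \<in> X p})"
        using block Suc.prems(1,4) by blast
      then have "card K \<le> card ({p \<in> K. c p \<in> C} \<union> (\<Union>w\<in>W. {p \<in> K. w \<in> X p}))"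
        using Suc.prems(2) W(1) by (intro card_mono) auto
      also have "\<dots> \<le> card {p \<in> K. c p \<in> C} + card (\<Union>w\<in>W. {p \<in> K. w \<in> X p})"
        by (rule card_Un_le)
      also have "card {p \<in> K. c p \<in> C} \<le> card C"
        using Suc.prems(3) C(1) by (intro card_inj_on_le[of c]) (auto intro: inj_on_subset)
      also have "card (\<Union>w\<in>W. {p \<in> K. w \<in> X p}) \<le> (\<Sum>w\<in>W. card {p \<in> K. w \<in> X p})"
        using W(1) by (rule card_UN_le)
      also have "\<dots> \<le> card W * (M - 1)"
        using sum_bounded_above[of W "\<lambda>w. card {p \<in> K. w \<in> X p}" "M - 1"] small by auto
      also have "\<dots> \<le> m * M"
        using W(2) by (intro mult_mono) auto
      finally show False
        using big C(2) \<open>M \<ge> s + 1\<close> by linarith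
    qed
    then obtain w where w: "w \<in> W" "card {p \<in> K. w \<in> X p} \<ge> M"
      by blast
    have "w \<notin> S" using w W(3) by blast
    have "\<exists>p\<in>{p \<in> K. w \<in> X p}. \<exists>T\<subseteq>X p. robust m s A X c T"
    proof (rule Suc.IH[where S = "insert w S"])
      show "inj_on c {p \<in> K. w \<in> X p}"
        using Suc.prems(3) by (rule inj_on_subset) auto
      show "insert w S \<subseteq> X p \<and> finite (X p) \<and> card (X p) = card (insert w S) + n"
        if "p \<in> {p \<in> K. w \<in> X p}" for p
      proof -
        have p: "S \<subseteq> X p" "finite (X p)" "card (X p) = card S + Suc n" "w \<in> X p"
          using that Suc.prems(4)[of p] by auto
        then have "finite S" by (metis finite_subset)
        then show ?thesis using p \<open>w \<notin> S\<close> by simp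
      qed
      show "{p \<in> K. w \<in> X p} \<subseteq> A"
        using Suc.prems(1) by blast
      show "card {p \<in> K. w \<in> X p} \<ge> (s + 1) * (m + 1) ^ n"
        using w(2) by (simp add: M_def)
    qed (simp add: Suc.prems(2))
    then show ?thesis by blast
  qed
qed

section \<open>The bound on the number of colors\<close>

text \<open>
  The two lemmas are combined with \<open>m = (t - 1) r\<close>, the number of vertices on \<open>t - 1\<close> edges, and
  \<open>s = t - 1\<close>: when one edge of the matching is chosen, at most \<open>t - 1\<close> others are in its way.
\<close>

lemma rainbow_free_colors_less:
  assumes col: "colored_r_graph r f t V E c" and free: "\<nexists>M. rainbow_t_matching t E c M"
  shows "f < t * ((t - 1) * r + 1) ^ r"
proof (rule ccontr)
  assume "\<not> ?thesis"
  then have large: "t * ((t - 1) * r + 1) ^ r \<le> f" by simp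
  have t: "t \<ge> 1"
  proof (rule ccontr)
    assume "\<not> t \<ge> 1"
    then have "rainbow_t_matching t E c {}"
      by (simp add: rainbow_t_matching_def t_matching_def)
    then show False using free by blast
  qed
  let ?A = "edge_copies E"
  let ?robust = "robust ((t - 1) * r) (t - 1) ?A fst c"
  have edge: "finite (fst p) \<and> card (fst p) = r" if "p \<in> ?A" for p
  proof -
    have "fst p \<in># E"
      using that by (auto simp: edge_copies_def simp flip: count_greater_zero_iff)
    then show ?thesis
      using col by (auto simp: colored_r_graph_def r_graph_def)
  qed
  \<comment> \<open>Otherwise one edge without robust subset per color forms a rainbow set of \<open>f\<close> edges.\<close>
  have "\<exists>i<f. \<forall>p\<in>?A. c p = i \<longrightarrow> (\<exists>S\<subseteq>fst p. ?robust S)"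
  proof (rule ccontr)
    assume "\<not> ?thesis"
    then have "\<forall>i\<in>{..<f}. \<exists>p. p \<in> ?A \<and> c p = i \<and> \<not> (\<exists>S\<subseteq>fst p. ?robust S)"
      by blast
    from bchoice[OF this] obtain q where q: "q i \<in> ?A" "c (q i) = i"
      "\<not> (\<exists>S\<subseteq>fst (q i). ?robust S)" if "i < f" for i
      by blast
    define K where "K = q ` {..<f}"
    have "inj_on q {..<f}"
      using q(2) by (metis inj_onI lessThan_iff)
    then have "card K = f"
      by (simp add: K_def card_image)
    have "\<exists>p\<in>K. \<exists>S\<subseteq>fst p. ?robust S"
    proof (rule large_rainbow_set_has_robust_subset[where S = "{}" and n = r])
      show "inj_on c K"
        using q(2) by (auto simp: K_def inj_on_def)
      show "card K \<ge> (t - 1 + 1) * ((t - 1) * r + 1) ^ r"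
        using large t \<open>card K = f\<close> by simp
      show "{} \<subseteq> fst p \<and> finite (fst p) \<and> card (fst p) = card {} + r" if "p \<in> K" for p
        using that q(1) edge[of p] by (auto simp: K_def)
      show "K \<subseteq> ?A" "finite K"
        using q(1) by (auto simp: K_def)
    qed
    then show False
      using q(3) unfolding K_def by blast
  qed
  then obtain i where i: "i < f" "\<And>p. p \<in> ?A \<Longrightarrow> c p = i \<Longrightarrow> \<exists>S\<subseteq>fst p. ?robust S"
    by blast
  define I where "I = {p \<in> ?A. c p = i}"
  have I: "finite I" "card I = t" "pairwise (\<lambda>p q. disjnt (fst p) (fst q)) I"
    using col i(1) by (simp_all add: I_def colored_r_graph_def t_matching_def)
  obtain S where S: "\<And>p. p \<in> I \<Longrightarrow> S p \<subseteq> fst p \<and> ?robust (S p)"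
    using i(2) unfolding I_def by (simp, metis)
  have "\<exists>g. g ` I \<subseteq> ?A \<and> disjoint_family_on (fst \<circ> g) I \<and> inj_on (c \<circ> g) I"
  proof (rule robust_family_extends_to_rainbow_matching[where S = S and r = r])
    show "disjoint_family_on S I"
      using I(3) S unfolding disjoint_family_on_def pairwise_def disjnt_def by blast
    show "finite (S p) \<and> card (S p) \<le> r" if "p \<in> I" for p
    proof -
      have "finite (fst p)" "card (fst p) = r" "S p \<subseteq> fst p"
        using edge[of p] S[OF that] that by (simp_all add: I_def)
      then show ?thesis
        using card_mono[of "fst p" "S p"] finite_subset[of "S p" "fst p"] by simp
    qed
    show "robust ((card I - 1) * r) (card I - 1) ?A fst c (S p)" if "p \<in> I" for p
      using S[OF that] I(2) by simp
    show "finite (fst p) \<and> card (fst p) \<le> r" if "p \<in> ?A" for p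
      using edge[OF that] by simp
  qed (rule I(1))
  then obtain g where g: "g ` I \<subseteq> ?A" "disjoint_family_on (fst \<circ> g) I" "inj_on (c \<circ> g) I"
    by blast
  have "card (g ` I) = t"
    using I(2) g(3) by (simp add: card_image inj_on_imageI2)
  moreover have "pairwise (\<lambda>p q. disjnt (fst p) (fst q)) (g ` I)"
    using g(2) unfolding pairwise_image
    by (metis (mono_tags, lifting) comp_apply disjnt_def disjoint_family_on_def pairwiseI)
  ultimately have "rainbow_t_matching t E c (g ` I)"
    using g I(1) by (simp add: rainbow_t_matching_def t_matching_def inj_on_imageI)
  then show False using free by blast
qed

theorem theorem2:
  fixes r t :: nat
  assumes "r \<ge> 2" and "t \<ge> 2"
  shows "max_colors_partite r t \<le> max_colors r t \<and>
         max_colors r t < enat ((r + 1) ^ (2 * r + 1) * t ^ (2 * r + 1))"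
proof
  have "partite_rainbow_free_sizes r t \<subseteq> rainbow_free_sizes r t"
    unfolding partite_rainbow_free_sizes_def rainbow_free_sizes_def by blast
  then show "max_colors_partite r t \<le> max_colors r t"
    unfolding max_colors_partite_def max_colors_def by (intro Sup_subset_mono image_mono)
next
  let ?b = "(r + 1) * t"
  have "t * ((t - 1) * r + 1) ^ r \<le> ?b * ?b ^ r"
  proof (intro mult_mono power_mono)
    show "(t - 1) * r + 1 \<le> ?b"
      using assms(2) by (cases t) auto
  qed auto
  also have "\<dots> = ?b ^ (r + 1)" by simp
  also have "\<dots> < ?b ^ (2 * r + 1)"
  proof (rule power_strict_increasing)
    have "1 * 1 < ?b"
      using assms by (intro mult_less_le_imp_less) auto
    then show "1 < ?b" by simp
  qed (use assms in simp)
  also have "\<dots> = (r + 1) ^ (2 * r + 1) * t ^ (2 * r + 1)"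
    by (rule power_mult_distrib)
  finally have bound: "t * ((t - 1) * r + 1) ^ r < (r + 1) ^ (2 * r + 1) * t ^ (2 * r + 1)" .
  have "max_colors r t \<le> enat (t * ((t - 1) * r + 1) ^ r)"
    unfolding max_colors_def
  proof (rule Sup_least)
    fix x assume "x \<in> enat ` rainbow_free_sizes r t"
    then obtain f and V :: "nat set" and E c where "x = enat f"
      "colored_r_graph r f t V E c" "\<nexists>M. rainbow_t_matching t E c M"
      unfolding rainbow_free_sizes_def by blast
    then show "x \<le> enat (t * ((t - 1) * r + 1) ^ r)"
      using rainbow_free_colors_less[of r f t V E c] by simp
  qed
  then show "max_colors r t < enat ((r + 1) ^ (2 * r + 1) * t ^ (2 * r + 1))"
    using bound by (metis enat_ord_simps(2) le_less_trans)
qed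

end
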